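(* For any constants $\alpha_1,\alpha_2,\alpha_3$, the $2\times 2$ matrix integro-differential operator $$M=M(u)=\begin{pmatrix}\alpha_1 q\partial^{-1}q & \alpha_2+\alpha_3\partial-\alpha_1 q\partial^{-1}r\\ -\alpha_2+\alpha_3\partial-\alpha_1 r\partial^{-1}q & \alpha_1 r\partial^{-1}r\end{pmatrix},\qquad u=\begin{pmatrix}q\\ r\end{pmatrix},$$ is a Hamiltonian operator.
   Context: Here $q=q(x,t)$, $r=r(x,t)$, $\partial=\partial/\partial x$, and $\partial^{-1}$ is the formal inverse of $\partial$, i.e. $\partial\partial^{-1}=\partial^{-1}\partial=1$; the calculus is formal. In an expression such as $q\partial^{-1}r$, the letters $q,r$ denote multiplication operators and juxtaposition denotes composition of operators. $\langle\cdot,\cdot\rangle$ is the standard inner product of $\mathbb{R}^2$. The Gateaux derivative of an operator $M(u)$ in direction $W$ is $M'[W]=\frac{d}{d\varepsilon}\big|_{\varepsilon=0}M(u+\varepsilon W)$. The notation $f\equiv 0\ (\mathrm{mod}\ \partial)$ means that $f$ is a total $x$-derivative. An operator $M=M(u)$ is Hamiltonian if it is skew-symmetric, i.e. $\langle Y,MX\rangle+\langle MY,X\rangle\equiv 0\ (\mathrm{mod}\ \partial)$, and it satisfies the Jacobi identity $$\langle Z,M'[MX]Y\rangle+\mathrm{cycle}(X,Y,Z)\equiv 0\ (\mathrm{mod}\ \partial)$$ for any two-dimensional vectors of functions $X,Y,Z$, where $\mathrm{cycle}(X,Y,Z)$ stands for the terms obtained by cyclic permutation of $X,Y,Z$. 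*)

theory Defs
  imports
    "HOL-Analysis.Product_Vector"
    "HOL-Computational_Algebra.Formal_Laurent_Series"
begin

text \<open>
  The calculus is formal: functions are the elements of a commutative real algebra on which the
  derivation \<open>D\<close> (for \<open>\<partial>/\<partial>x\<close>) has a two-sided inverse \<open>Dinv\<close> (for \<open>\<partial>\<^sup>-\<^sup>1\<close>). The algebra must
  not be required to have a unit, since \<open>D 1 = 0\<close> contradicts the injectivity of \<open>D\<close>; the constants
  are the real scalars. The variable \<open>t\<close> is an inert parameter.
\<close>

locale formal_calculus =
  fixes D Dinv :: "'a::{comm_ring,real_algebra} \<Rightarrow> 'a"
  assumes D_linear: "linear D"
    and D_product: "D (f * g) = D f * g + f * D g"
    and D_Dinv: "D (Dinv f) = f"
    and Dinv_D: "Dinv (D f) = f"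

text \<open>
  The relation \<open>f \<equiv> 0 (mod \<partial>)\<close>. As \<open>f = D (Dinv f)\<close> for every \<open>f\<close>, the condition
  \<open>\<exists>g. f = D g\<close> alone would be void. What is meant is that \<open>f\<close> is the derivative of an expression
  that is not merely the formal antiderivative of \<open>f\<close> again, i.e. of a linear combination of
  products \<open>g * h\<close> (where \<open>g\<close> and \<open>h\<close> may be nonlocal), as it arises from integration by parts.
  This implies \<open>\<exists>g. f = D g\<close>, and by \<open>total_derivative_nontrivial\<close> below it is a proper
  restriction even for products \<open>f\<close>.
\<close>

definition total_derivative :: "('a::{comm_ring,real_algebra} \<Rightarrow> 'a) \<Rightarrow> 'a \<Rightarrow> bool" where
  "total_derivative D f \<longleftrightarrow> (\<exists>p \<in> span {g * h | g h. True}. f = D p)"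

definition inner2 :: "'a::comm_ring \<times> 'a \<Rightarrow> 'a \<times> 'a \<Rightarrow> 'a" where
  "inner2 X Y = fst X * fst Y + snd X * snd Y"

definition op_matrix ::
  "('a::comm_ring \<Rightarrow> 'a) \<Rightarrow> ('a \<Rightarrow> 'a) \<Rightarrow> ('a \<Rightarrow> 'a) \<Rightarrow> ('a \<Rightarrow> 'a) \<Rightarrow> 'a \<times> 'a \<Rightarrow> 'a \<times> 'a" where
  "op_matrix A B C E X = (A (fst X) + B (snd X), C (fst X) + E (snd X))"

text \<open>
  The derivative at \<open>0\<close> of a curve in a real vector space without a topology, taken through all
  linear functionals. These separate points, so the derivative is unique; for a curve in a
  finite-dimensional subspace, such as a polynomial one, it is the usual derivative.
\<close>

definition has_derivative_at_0 :: "(real \<Rightarrow> 'v::real_vector) \<Rightarrow> 'v \<Rightarrow> bool" where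
  "has_derivative_at_0 c v \<longleftrightarrow>
     (\<forall>\<phi> :: 'v \<Rightarrow> real. linear \<phi> \<longrightarrow> ((\<lambda>\<epsilon>. \<phi> (c \<epsilon>)) has_real_derivative \<phi> v) (at 0))"

text \<open>An operator \<open>M\<close> depending on \<open>u\<close> is a function \<open>M u X\<close>; \<open>gateaux M u W Y\<close> is \<open>M'[W] Y\<close> at \<open>u\<close>.\<close>

definition gateaux_differentiable :: "('v::real_vector \<Rightarrow> 'v \<Rightarrow> 'v) \<Rightarrow> bool" where
  "gateaux_differentiable M \<longleftrightarrow>
     (\<forall>u W Y. \<exists>v. has_derivative_at_0 (\<lambda>\<epsilon>. M (u + \<epsilon> *\<^sub>R W) Y) v)"

definition gateaux :: "('v::real_vector \<Rightarrow> 'v \<Rightarrow> 'v) \<Rightarrow> 'v \<Rightarrow> 'v \<Rightarrow> 'v \<Rightarrow> 'v" where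
  "gateaux M u W Y = (THE v. has_derivative_at_0 (\<lambda>\<epsilon>. M (u + \<epsilon> *\<^sub>R W) Y) v)"

definition skew_symmetric ::
  "('a::{comm_ring,real_algebra} \<Rightarrow> 'a) \<Rightarrow> ('a \<times> 'a \<Rightarrow> 'a \<times> 'a \<Rightarrow> 'a \<times> 'a) \<Rightarrow> bool" where
  "skew_symmetric D M \<longleftrightarrow>
     (\<forall>u X Y. total_derivative D (inner2 Y (M u X) + inner2 (M u Y) X))"

definition jacobi_identity ::
  "('a::{comm_ring,real_algebra} \<Rightarrow> 'a) \<Rightarrow> ('a \<times> 'a \<Rightarrow> 'a \<times> 'a \<Rightarrow> 'a \<times> 'a) \<Rightarrow> bool" where
  "jacobi_identity D M \<longleftrightarrow>
     (\<forall>u X Y Z. total_derivative D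
        (inner2 Z (gateaux M u (M u X) Y) +
         inner2 X (gateaux M u (M u Y) Z) +
         inner2 Y (gateaux M u (M u Z) X)))"

definition hamiltonian ::
  "('a::{comm_ring,real_algebra} \<Rightarrow> 'a) \<Rightarrow> ('a \<times> 'a \<Rightarrow> 'a \<times> 'a \<Rightarrow> 'a \<times> 'a) \<Rightarrow> bool" where
  "hamiltonian D M \<longleftrightarrow>
     skew_symmetric D M \<and> gateaux_differentiable M \<and> jacobi_identity D M"

definition M_op ::
  "('a::{comm_ring,real_algebra} \<Rightarrow> 'a) \<Rightarrow> ('a \<Rightarrow> 'a) \<Rightarrow> real \<Rightarrow> real \<Rightarrow> real \<Rightarrow>
   'a \<times> 'a \<Rightarrow> 'a \<times> 'a \<Rightarrow> 'a \<times> 'a" where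
  "M_op D Dinv \<alpha>1 \<alpha>2 \<alpha>3 u = (let q = fst u; r = snd u in
     op_matrix
       (\<lambda>f. \<alpha>1 *\<^sub>R (q * Dinv (q * f)))
       (\<lambda>f. \<alpha>2 *\<^sub>R f + \<alpha>3 *\<^sub>R D f - \<alpha>1 *\<^sub>R (q * Dinv (r * f)))
       (\<lambda>f. - (\<alpha>2 *\<^sub>R f) + \<alpha>3 *\<^sub>R D f - \<alpha>1 *\<^sub>R (r * Dinv (q * f)))
       (\<lambda>f. \<alpha>1 *\<^sub>R (r * Dinv (r * f))))"

text \<open>
  A small model showing that \<open>total_derivative\<close> is not void. Linear terms carry one of two symbols
  \<open>1 + z\<close> and \<open>-1\<close>, whose sum is the symbol \<open>z\<close> of a quadratic term; \<open>D\<close> multiplies by the symbol.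
\<close>

datatype model = Mod (lin1: "real fps") (lin2: "real fps") (quad: "real fls")

instantiation model :: "{comm_ring,real_algebra}"
begin
definition "0 = Mod 0 0 0"
definition "a + b = Mod (lin1 a + lin1 b) (lin2 a + lin2 b) (quad a + quad b)"
definition "- a = Mod (- lin1 a) (- lin2 a) (- quad a)"
definition "a - b = Mod (lin1 a - lin1 b) (lin2 a - lin2 b) (quad a - quad b)"
definition "a * b = Mod 0 0 (fps_to_fls (lin1 a * lin2 b + lin2 a * lin1 b))"
definition "c *\<^sub>R a = Mod (fps_const c * lin1 a) (fps_const c * lin2 a) (fls_const c * quad a)"
instance
  by standard
    (simp_all add: zero_model_def plus_model_def uminus_model_def minus_model_def times_model_def
      scaleR_model_def algebra_simps fls_times_fps_to_fls
      flip: fps_const_add fps_const_mult fls_const_mult_const fls_plus_const)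
end

definition D_model :: "model \<Rightarrow> model" where
  "D_model a = Mod ((1 + fps_X) * lin1 a) (- lin2 a) (fls_X * quad a)"

definition Dinv_model :: "model \<Rightarrow> model" where
  "Dinv_model a = Mod (inverse (1 + fps_X) * lin1 a) (- lin2 a) (fls_X_inv * quad a)"

lemma formal_calculus_model: "formal_calculus D_model Dinv_model"
proof
  have s: "(1 + fps_X) * inverse (1 + fps_X) = (1 :: real fps)"
    by (rule inverse_mult_eq_1') simp
  have z: "fls_X * fls_X_inv = (1 :: real fls)"
    by (simp flip: fls_inverse_X)
  fix f g :: model and c :: real
  show "D_model (f + g) = D_model f + D_model g"
    by (simp add: D_model_def plus_model_def algebra_simps)
  show "D_model (c *\<^sub>R f) = c *\<^sub>R D_model f"
    by (simp add: D_model_def scaleR_model_def algebra_simps)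
  show "D_model (f * g) = D_model f * g + f * D_model g"
    by (simp add: D_model_def times_model_def plus_model_def algebra_simps fls_times_fps_to_fls)
  show "D_model (Dinv_model f) = f"
    by (cases f) (simp add: D_model_def Dinv_model_def s z flip: mult.assoc)
  show "Dinv_model (D_model f) = f"
    by (cases f) (simp add: D_model_def Dinv_model_def s z mult.commute[of "inverse _"]
      mult.commute[of fls_X_inv] flip: mult.assoc)
qed

lemma total_derivative_nontrivial: "\<exists>f. \<not> total_derivative D_model (f * f)"
proof
  let ?S = "{a :: model. \<exists>h. quad a = fps_to_fls h}"
  have "subspace ?S"
  proof (rule subspaceI)
    show "0 \<in> ?S"
      by (auto simp: zero_model_def intro: exI[of _ 0])
  next
    fix a b :: model assume "a \<in> ?S" "b \<in> ?S"
    then obtain h k where "quad a = fps_to_fls h" "quad b = fps_to_fls k" by auto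
    then have "quad (a + b) = fps_to_fls (h + k)" by (simp add: plus_model_def)
    then show "a + b \<in> ?S" by blast
  next
    fix a :: model and c :: real assume "a \<in> ?S"
    then obtain h where "quad a = fps_to_fls h" by auto
    then have "quad (c *\<^sub>R a) = fps_to_fls (fps_const c * h)"
      by (simp add: scaleR_model_def fls_times_fps_to_fls)
    then show "c *\<^sub>R a \<in> ?S" by blast
  qed
  moreover have "{g * h | g h. True} \<subseteq> ?S"
  proof clarify
    fix g h :: model
    show "\<exists>k. quad (g * h) = fps_to_fls k" unfolding times_model_def model.sel by blast
  qed
  ultimately have S: "span {g * h | g h. True} \<subseteq> ?S"
    by (intro span_minimal)
  let ?f = "Mod 1 1 0"
  show "\<not> total_derivative D_model (?f * ?f)"
  proof
    assume "total_derivative D_model (?f * ?f)"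
    then obtain p where "p \<in> ?S" and p: "?f * ?f = D_model p"
      using S unfolding total_derivative_def by blast
    then obtain h where "quad p = fps_to_fls h" by blast
    with p have "fps_to_fls 2 = fps_to_fls (fps_X * h)"
      by (simp add: times_model_def D_model_def fls_times_fps_to_fls)
    then have "2 = fps_X * h"
      by (simp only: fps_to_fls_eq_iff)
    then have "(2 :: real fps) $ 0 = (fps_X * h) $ 0"
      by (rule arg_cong)
    then show False by simp
  qed
qed

end

theory Submission imports Defs begin

text \<open>
  With \<open>P X = \<partial>\<^sup>-\<^sup>1 (q X\<^sub>1 - r X\<^sub>2)\<close> the operator takes the form
  \<open>M X = \<alpha>\<^sub>1 P X (q, -r) + \<alpha>\<^sub>2 (X\<^sub>2, -X\<^sub>1) + \<alpha>\<^sub>3 (\<partial>X\<^sub>2, \<partial>X\<^sub>1)\<close>, and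
  \<open>M(u + \<epsilon>W) Y\<close> is quadratic in \<open>\<epsilon>\<close>. One integration by parts per cyclic term moves the
  \<open>\<partial>\<^sup>-\<^sup>1\<close> off the variation of \<open>P\<close> in the Jacobi sum. After that the \<open>\<alpha>\<^sub>1\<close> and \<open>\<alpha>\<^sub>2\<close> parts cancel
  by symmetry, and the \<open>\<alpha>\<^sub>3\<close> part is the cyclic sum of \<open>P Y \<partial>(X\<^sub>2 Z\<^sub>1 - X\<^sub>1 Z\<^sub>2)\<close>, which becomes
  zero after a second integration by parts, because the cyclic sum of \<open>Y\<^sub>i (X\<^sub>2 Z\<^sub>1 - X\<^sub>1 Z\<^sub>2)\<close> is a
  determinant with two equal rows.
\<close>

text \<open>Purely algebraic: \<open>{v}\<close> extends to a Hamel basis, on which values may be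
  prescribed freely.\<close>

lemma linear_functional_separates:
  fixes v :: "'v::real_vector"
  assumes "v \<noteq> 0"
  obtains \<phi> :: "'v \<Rightarrow> real" where "linear \<phi>" "\<phi> v = 1"
proof -
  have "independent {v}" using assms by simp
  from linear_independent_extend[OF this, of "\<lambda>_. 1 :: real"] show ?thesis
    using that by blast
qed

lemma has_derivative_at_0_unique:
  assumes "has_derivative_at_0 c v" "has_derivative_at_0 c w"
  shows "v = w"
proof (rule ccontr)
  assume "v \<noteq> w"
  then obtain \<phi> :: "'a \<Rightarrow> real" where \<phi>: "linear \<phi>" "\<phi> (v - w) = 1"
    using linear_functional_separates[of "v - w"] by auto
  then have "\<phi> v = \<phi> w"
    using assms unfolding has_derivative_at_0_def by (blast intro: DERIV_unique)
  with \<phi> show False by (simp add: linear_diff)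
qed

lemma has_derivative_at_0_quadratic:
  "has_derivative_at_0 (\<lambda>\<epsilon>. a + \<epsilon> *\<^sub>R v + \<epsilon>\<^sup>2 *\<^sub>R w) v"
  unfolding has_derivative_at_0_def
proof (intro allI impI)
  fix \<phi> :: "'a \<Rightarrow> real" assume "linear \<phi>"
  then have "\<phi> (a + \<epsilon> *\<^sub>R v + \<epsilon>\<^sup>2 *\<^sub>R w) = \<phi> a + \<epsilon> * \<phi> v + \<epsilon>\<^sup>2 * \<phi> w" for \<epsilon>
    by (simp add: linear_add linear_scale)
  then show "((\<lambda>\<epsilon>. \<phi> (a + \<epsilon> *\<^sub>R v + \<epsilon>\<^sup>2 *\<^sub>R w)) has_real_derivative \<phi> v) (at 0)"
    by (auto intro!: derivative_eq_intros)
qed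

lemma gateaux_eqI:
  assumes "has_derivative_at_0 (\<lambda>\<epsilon>. M (u + \<epsilon> *\<^sub>R W) Y) v"
  shows "gateaux M u W Y = v"
  unfolding gateaux_def
  using assms by (blast intro: the_equality has_derivative_at_0_unique)

text \<open>The boundary terms of all integrations by parts below have this shape.\<close>

lemma total_derivative_mult: "total_derivative D (D (g * h))"
  unfolding total_derivative_def by (blast intro: span_base)

context formal_calculus
begin

lemmas D_add = linear_add[OF D_linear]
  and D_diff = linear_diff[OF D_linear]
  and D_scale = linear_scale[OF D_linear]

lemma Dinv_linear: "linear Dinv"
proof (rule linearI)
  fix f g and c :: real
  show "Dinv (f + g) = Dinv f + Dinv g"
    by (metis D_Dinv Dinv_D D_add)
  show "Dinv (c *\<^sub>R f) = c *\<^sub>R Dinv f"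
    by (metis D_Dinv Dinv_D D_scale)
qed

lemmas Dinv_add = linear_add[OF Dinv_linear]
  and Dinv_diff = linear_diff[OF Dinv_linear]
  and Dinv_scale = linear_scale[OF Dinv_linear]

lemma total_derivative_add:
  assumes "total_derivative D f" "total_derivative D g"
  shows "total_derivative D (f + g)"
  using assms unfolding total_derivative_def by (auto simp flip: D_add intro: span_add)

lemma total_derivative_scale:
  assumes "total_derivative D f"
  shows "total_derivative D (c *\<^sub>R f)"
  using assms unfolding total_derivative_def by (auto simp flip: D_scale intro: span_scale)

definition P :: "'a \<times> 'a \<Rightarrow> 'a \<times> 'a \<Rightarrow> 'a" where
  "P u X = Dinv (fst u * fst X - snd u * snd X)"

lemma D_P: "D (P u X) = fst u * fst X - snd u * snd X"
  by (simp add: P_def D_Dinv)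

lemma P_add_left: "P (u + v) X = P u X + P v X"
  by (simp add: P_def algebra_simps flip: Dinv_add Dinv_diff)

lemma P_scale_left: "P (c *\<^sub>R u) X = c *\<^sub>R P u X"
  by (simp add: P_def algebra_simps flip: Dinv_scale)

lemma M_op_eq:
  "M_op D Dinv \<alpha>1 \<alpha>2 \<alpha>3 u X =
    (\<alpha>1 *\<^sub>R (fst u * P u X) + \<alpha>2 *\<^sub>R snd X + \<alpha>3 *\<^sub>R D (snd X),
     - (\<alpha>1 *\<^sub>R (snd u * P u X)) - \<alpha>2 *\<^sub>R fst X + \<alpha>3 *\<^sub>R D (fst X))"
  by (simp add: M_op_def op_matrix_def Let_def P_def Dinv_diff algebra_simps)

text \<open>The \<alpha>2 and \<alpha>3 parts of the operator are constant in \<open>u\<close> and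
  drop out; since \<open>P\<close> is linear in \<open>u\<close>, the product rule leaves two terms
  per component.\<close>

definition M_deriv :: "real \<Rightarrow> 'a \<times> 'a \<Rightarrow> 'a \<times> 'a \<Rightarrow> 'a \<times> 'a \<Rightarrow> 'a \<times> 'a" where
  "M_deriv \<alpha>1 u W Y =
    (\<alpha>1 *\<^sub>R (fst W * P u Y + fst u * P W Y), - (\<alpha>1 *\<^sub>R (snd W * P u Y + snd u * P W Y)))"

lemma M_op_has_derivative:
  "has_derivative_at_0 (\<lambda>\<epsilon>. M_op D Dinv \<alpha>1 \<alpha>2 \<alpha>3 (u + \<epsilon> *\<^sub>R W) Y) (M_deriv \<alpha>1 u W Y)"
proof -
  have "M_op D Dinv \<alpha>1 \<alpha>2 \<alpha>3 (u + \<epsilon> *\<^sub>R W) Y =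
      M_op D Dinv \<alpha>1 \<alpha>2 \<alpha>3 u Y + \<epsilon> *\<^sub>R M_deriv \<alpha>1 u W Y
      + \<epsilon>\<^sup>2 *\<^sub>R (\<alpha>1 *\<^sub>R (fst W * P W Y), - (\<alpha>1 *\<^sub>R (snd W * P W Y)))" for \<epsilon>
    by (simp add: M_op_eq M_deriv_def P_add_left P_scale_left power2_eq_square algebra_simps)
  then show ?thesis
    by (simp only: has_derivative_at_0_quadratic)
qed

lemma skew_symmetric_M_op: "skew_symmetric D (M_op D Dinv \<alpha>1 \<alpha>2 \<alpha>3)"
  unfolding skew_symmetric_def
proof (intro allI)
  fix u X Y :: "'a \<times> 'a"
  \<comment> \<open>Pairing \<open>Y\<close> with \<open>(fst u, - snd u)\<close> gives
    \<open>D (P u Y)\<close>, so the \<alpha>1 terms combine by the product rule; the \<alpha>2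
    terms cancel outright.\<close>
  have "inner2 Y (M_op D Dinv \<alpha>1 \<alpha>2 \<alpha>3 u X) + inner2 (M_op D Dinv \<alpha>1 \<alpha>2 \<alpha>3 u Y) X =
      \<alpha>1 *\<^sub>R D (P u X * P u Y) + \<alpha>3 *\<^sub>R (D (fst Y * snd X) + D (snd Y * fst X))"
    by (simp add: M_op_eq inner2_def D_product D_P algebra_simps)
  then show "total_derivative D
      (inner2 Y (M_op D Dinv \<alpha>1 \<alpha>2 \<alpha>3 u X) + inner2 (M_op D Dinv \<alpha>1 \<alpha>2 \<alpha>3 u Y) X)"
    by (simp add: total_derivative_add total_derivative_scale total_derivative_mult)
qed

text \<open>Pairing \<open>Z\<close> with \<open>(fst W, - snd W)\<close> gives
  \<open>D (P W Z)\<close>, and likewise for \<open>u\<close>. Integrating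
  \<open>D (P u Z) * P W Y\<close> by parts then leaves \<open>P W\<close> only under
  \<open>D\<close> outside the boundary term, so \<open>D_P\<close> removes its
  \<open>Dinv\<close>.\<close>

lemma inner2_M_deriv:
  "inner2 Z (M_deriv \<alpha>1 u W Y) =
    \<alpha>1 *\<^sub>R (D (P u Z * P W Y) + (D (P W Z) * P u Y - P u Z * D (P W Y)))"
  by (simp add: M_deriv_def inner2_def D_product D_P algebra_simps)

lemma jacobi_identity_M_op: "jacobi_identity D (M_op D Dinv \<alpha>1 \<alpha>2 \<alpha>3)"
  unfolding jacobi_identity_def
proof (intro allI)
  fix u X Y Z :: "'a \<times> 'a"
  let ?M = "M_op D Dinv \<alpha>1 \<alpha>2 \<alpha>3 u"
  define R where "R V Y Z = D (P (?M V) Z) * P u Y - P u Z * D (P (?M V) Y)" for V Y Z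
  define w where "w X Z = snd X * fst Z - fst X * snd Z" for X Z :: "'a \<times> 'a"
  have det: "D (P u Y) * w X Z + D (P u Z) * w Y X + D (P u X) * w Z Y = 0"
    by (simp add: D_P w_def algebra_simps)
  have Dw: "D (w X Z) = D (snd X) * fst Z + snd X * D (fst Z) - D (fst X) * snd Z - fst X * D (snd Z)"
    for X Z by (simp add: w_def D_diff D_product algebra_simps)
  \<comment> \<open>In \<open>D (P (?M V) Z)\<close> the \<alpha>1 part is \<open>P u V\<close>
    times a function of \<open>Z\<close>, and the \<alpha>2 part is symmetric in \<open>V\<close>
    and \<open>Z\<close>; both cancel in the cyclic sum. The \<alpha>3 part gets antisymmetrized
    into \<open>D (w V Z)\<close>.\<close>
  have "R X Y Z + R Y Z X + R Z X Y =
      \<alpha>3 *\<^sub>R (P u Y * D (w X Z) + P u Z * D (w Y X) + P u X * D (w Z Y))"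
    unfolding R_def Dw by (simp add: D_P M_op_eq algebra_simps)
  \<comment> \<open>The product rule adds exactly the three terms whose sum vanishes by
    \<open>det\<close>.\<close>
  also have "P u Y * D (w X Z) + P u Z * D (w Y X) + P u X * D (w Z Y) =
      D (P u Y * w X Z) + D (P u Z * w Y X) + D (P u X * w Z Y)"
    using det by (simp add: D_product algebra_simps)
  finally have R: "total_derivative D (R X Y Z + R Y Z X + R Z X Y)"
    by (simp add: total_derivative_add total_derivative_scale total_derivative_mult)
  have "inner2 Z (gateaux (M_op D Dinv \<alpha>1 \<alpha>2 \<alpha>3) u (?M X) Y) +
      inner2 X (gateaux (M_op D Dinv \<alpha>1 \<alpha>2 \<alpha>3) u (?M Y) Z) +
      inner2 Y (gateaux (M_op D Dinv \<alpha>1 \<alpha>2 \<alpha>3) u (?M Z) X) =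
      \<alpha>1 *\<^sub>R (D (P u Z * P (?M X) Y) + D (P u X * P (?M Y) Z) + D (P u Y * P (?M Z) X)
        + (R X Y Z + R Y Z X + R Z X Y))"
    unfolding gateaux_eqI[OF M_op_has_derivative] inner2_M_deriv R_def
    by (simp add: scaleR_add_right scaleR_diff_right)
  then show "total_derivative D
     (inner2 Z (gateaux (M_op D Dinv \<alpha>1 \<alpha>2 \<alpha>3) u (?M X) Y) +
      inner2 X (gateaux (M_op D Dinv \<alpha>1 \<alpha>2 \<alpha>3) u (?M Y) Z) +
      inner2 Y (gateaux (M_op D Dinv \<alpha>1 \<alpha>2 \<alpha>3) u (?M Z) X))"
    by (simp only: total_derivative_add total_derivative_scale total_derivative_mult R)
qed

lemma gateaux_differentiable_M_op: "gateaux_differentiable (M_op D Dinv \<alpha>1 \<alpha>2 \<alpha>3)"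
  unfolding gateaux_differentiable_def using M_op_has_derivative by blast

end

theorem proposition1:
  fixes D Dinv :: "'a::{comm_ring,real_algebra} \<Rightarrow> 'a"
    and \<alpha>1 \<alpha>2 \<alpha>3 :: real
  assumes "formal_calculus D Dinv"
  shows "hamiltonian D (M_op D Dinv \<alpha>1 \<alpha>2 \<alpha>3)"
proof -
  interpret formal_calculus D Dinv by (fact assms)
  show ?thesis
    unfolding hamiltonian_def
    using skew_symmetric_M_op gateaux_differentiable_M_op jacobi_identity_M_op by blast
qed

end
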